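(* Let $T:\mathbb{R}^n\to\mathbb{R}^n$ be a monotone additively homogeneous map. The following assertions are equivalent: (i) for every $g\in\mathbb{R}^n$, the ergodic equation $g+T(u)=\lambda e+u$ has a solution $(\lambda,u)\in\mathbb{R}\times\mathbb{R}^n$; (ii) for every monotone additively homogeneous map $G:\mathbb{R}^n\to\mathbb{R}^n$ such that $\sup_{x\in\mathbb{R}^n}\|G(x)-T(x)\|_{\mathrm H}<\infty$, the ergodic equation $G(u)=\lambda e+u$ has a solution $(\lambda,u)\in\mathbb{R}\times\mathbb{R}^n$; (iii) the set $\mathcal{D}_\alpha^{\mathrm H}(T):=\{x\in\mathbb{R}^n\mid\|x-T(x)\|_{\mathrm H}\leq\alpha\}$ is bounded in Hilbert's seminorm for all $\alpha\geq0$; (iv) the slice space $\mathcal{S}_\alpha^\beta(T)=\{x\in\mathbb{R}^n\mid\alpha e+x\leq T(x)\leq\beta e+x\}$ is bounded in Hilbert's seminorm for all $\alpha,\beta\in\mathbb{R}$.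
   Context: $\mathbb{R}^n$ carries its coordinatewise partial order, and $e=(1,\dots,1)^\top$. A map $T:\mathbb{R}^n\to\mathbb{R}^n$ is monotone if $x\leq y$ implies $T(x)\leq T(y)$, and additively homogeneous if $T(x+\alpha e)=T(x)+\alpha e$ for all $x\in\mathbb{R}^n$, $\alpha\in\mathbb{R}$. Hilbert's seminorm is $\|x\|_{\mathrm H}=\max_i x_i-\min_i x_i$; a set is bounded in Hilbert's seminorm if $\|\cdot\|_{\mathrm H}$ is bounded on it (the empty set is bounded). *)

theory Defs
  imports "HOL-Analysis.Analysis"
begin

(* The order on real ^ 'n is coordinatewise, and the vector e = (1,...,1) is the library's
   constant 1 :: real ^ 'n (one_vec_def). *)

definition additively_homogeneous :: "(real ^ 'n \<Rightarrow> real ^ 'n) \<Rightarrow> bool" where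
  "additively_homogeneous T \<longleftrightarrow> (\<forall>x \<alpha>. T (x + \<alpha> *\<^sub>R 1) = T x + \<alpha> *\<^sub>R 1)"

definition hilbert_seminorm :: "real ^ 'n \<Rightarrow> real" where
  "hilbert_seminorm x = Max (range (\<lambda>i. x $ i)) - Min (range (\<lambda>i. x $ i))"

definition hilbert_bounded :: "(real ^ 'n) set \<Rightarrow> bool" where
  "hilbert_bounded S \<longleftrightarrow> (\<exists>B. \<forall>x\<in>S. hilbert_seminorm x \<le> B)"

definition hilbert_displacement_set :: "real \<Rightarrow> (real ^ 'n \<Rightarrow> real ^ 'n) \<Rightarrow> (real ^ 'n) set" where
  "hilbert_displacement_set \<alpha> T = {x. hilbert_seminorm (x - T x) \<le> \<alpha>}"

definition slice_space :: "real \<Rightarrow> real \<Rightarrow> (real ^ 'n \<Rightarrow> real ^ 'n) \<Rightarrow> (real ^ 'n) set" where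
  "slice_space \<alpha> \<beta> T = {x. \<alpha> *\<^sub>R 1 + x \<le> T x \<and> T x \<le> \<beta> *\<^sub>R 1 + x}"

end

theory Submission
  imports Defs
begin

text \<open>
  The implication from the ergodic equation to boundedness is a duality argument. If
  \<open>x\<^sub>k\<close> has Hilbert seminorm \<open>N\<^sub>k \<rightarrow> \<infinity>\<close> while \<open>T x\<^sub>k - x\<^sub>k\<close> stays bounded, pass to a subsequence with
  \<open>x\<^sub>k / N\<^sub>k \<rightarrow> w\<close> and \<open>T x\<^sub>k - x\<^sub>k \<rightarrow> d\<close> modulo constants, and solve the ergodic equation with
  \<open>g = w - d\<close>, giving \<open>z\<close> with \<open>T z - z = d - w\<close> modulo constants. Monotonicity and homogeneity
  yield \<open>T x\<^sub>k - x\<^sub>k \<le> T z - z\<close> at a coordinate maximising \<open>x\<^sub>k - z\<close> and the reverse inequality at a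
  minimising one; since \<open>w\<close> is nearly maximal at the first and nearly minimal at the second, this
  is impossible for large \<open>k\<close>.
  Conversely, Brouwer's theorem provides fixed points of \<open>v \<mapsto> G ((1 - a) v)\<close>; the vectors
  \<open>(1 - a) v\<close> lie in one displacement set, so they are bounded modulo constants, and their limit
  points as \<open>a \<rightarrow> 0\<close> solve the ergodic equation.
\<close>

section \<open>Hilbert's seminorm through coordinate differences\<close>

lemma hilbert_seminorm_attained:
  fixes x :: "real ^ 'n"
  obtains i j where "hilbert_seminorm x = x $ i - x $ j" "\<And>k. x $ k \<le> x $ i" "\<And>k. x $ j \<le> x $ k"
proof -
  let ?R = "range (\<lambda>i. x $ i)"
  have "Max ?R \<in> ?R" "Min ?R \<in> ?R" by (auto intro!: Max_in Min_in)
  then obtain i j where ij: "Max ?R = x $ i" "Min ?R = x $ j" by blast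
  have "x $ k \<le> Max ?R" "Min ?R \<le> x $ k" for k by auto
  with ij show thesis by (intro that[of i j]) (auto simp: hilbert_seminorm_def)
qed

lemma hilbert_seminorm_le_iff:
  fixes x :: "real ^ 'n"
  shows "hilbert_seminorm x \<le> c \<longleftrightarrow> (\<forall>i j. x $ i - x $ j \<le> c)"
proof -
  obtain i j where "hilbert_seminorm x = x $ i - x $ j" "\<And>k. x $ k \<le> x $ i" "\<And>k. x $ j \<le> x $ k"
    using hilbert_seminorm_attained by blast
  then show ?thesis by (metis diff_mono order_trans)
qed

lemma hilbert_seminorm_nonneg: "0 \<le> hilbert_seminorm x"
  using hilbert_seminorm_le_iff[of x "hilbert_seminorm x"] by (metis diff_self order_refl)

lemma diff_le_hilbert_seminorm: "x $ i - x $ j \<le> hilbert_seminorm x"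
  using hilbert_seminorm_le_iff by blast

lemma hilbert_seminorm_le_0D:
  assumes "hilbert_seminorm x \<le> 0"
  shows "\<exists>c. x = c *\<^sub>R 1"
proof -
  have "x $ i = x $ j" for i j
    using assms hilbert_seminorm_le_iff[of x 0] by (metis antisym diff_le_0_iff_le)
  then have "x = (x $ undefined) *\<^sub>R 1" by (simp add: vec_eq_iff)
  then show ?thesis by blast
qed

section \<open>Monotone additively homogeneous maps\<close>

text \<open>Homogeneity turns the bound by the translate \<open>y + c *\<^sub>R 1\<close> into a
  bound on images. Being one-sided, it applies at a coordinate where a difference of two points is
  extremal.\<close>

lemma mono_homogeneous_nth_le:
  assumes "mono T" "additively_homogeneous T" "\<And>k. x $ k \<le> y $ k + c"
  shows "T x $ i \<le> T y $ i + c"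
proof -
  have "x \<le> y + c *\<^sub>R 1" using assms(3) by (simp add: less_eq_vec_def)
  then have "T x \<le> T (y + c *\<^sub>R 1)" using assms(1) by (rule monoD[rotated])
  also have "\<dots> = T y + c *\<^sub>R 1" using assms(2) by (simp add: additively_homogeneous_def)
  finally show ?thesis by (simp add: less_eq_vec_def)
qed

text \<open>Nonexpansiveness in the sup norm, the source of continuity and of the invariant cube for
  Brouwer's theorem.\<close>

lemma mono_homogeneous_nth_nonexpansive:
  assumes "mono T" "additively_homogeneous T" "\<And>k. \<bar>x $ k - y $ k\<bar> \<le> c"
  shows "\<bar>T x $ i - T y $ i\<bar> \<le> c"
proof -
  have "x $ k \<le> y $ k + c" "y $ k \<le> x $ k + c" for k using assms(3)[of k] by linarith+
  then have "T x $ i \<le> T y $ i + c" "T y $ i \<le> T x $ i + c"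
    using mono_homogeneous_nth_le[OF assms(1,2)] by blast+
  then show ?thesis by linarith
qed

lemma continuous_on_mono_homogeneous:
  fixes T :: "real ^ 'n \<Rightarrow> real ^ 'n"
  assumes "mono T" "additively_homogeneous T"
  shows "continuous_on S T"
proof -
  have "continuous_on UNIV (\<lambda>x. T x $ i)" for i
  proof (rule continuous_onI)
    fix x :: "real ^ 'n" and e :: real
    assume "e > 0"
    moreover have "dist (T y $ i) (T x $ i) \<le> dist y x" for y
      unfolding dist_real_def
    proof (rule mono_homogeneous_nth_nonexpansive[OF assms])
      show "\<bar>y $ k - x $ k\<bar> \<le> dist y x" for k
        using component_le_norm_cart[of "y - x" k] by (simp add: dist_norm)
    qed
    ultimately show "\<exists>d>0. \<forall>y\<in>UNIV. dist y x < d \<longrightarrow> dist (T y $ i) (T x $ i) \<le> e"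
      by (metis less_imp_le order_trans)
  qed
  then have "continuous_on UNIV (\<lambda>x. \<chi> i. T x $ i)" by (rule continuous_on_vec_lambda)
  then show ?thesis by (auto intro: continuous_on_subset)
qed

section \<open>Comparison of displacement sets and slice spaces\<close>

text \<open>Subadditivity of the seminorm along \<open>x - T x = (x - G x) + (G x - T x)\<close>.
  This carries boundedness from \<open>T\<close> over to every \<open>G\<close> at bounded
  distance.\<close>

lemma hilbert_displacement_set_subset:
  assumes "\<And>x. hilbert_seminorm (G x - T x) \<le> K"
  shows "hilbert_displacement_set \<alpha> G \<subseteq> hilbert_displacement_set (\<alpha> + K) T"
proof
  fix x
  assume "x \<in> hilbert_displacement_set \<alpha> G"
  then have "(x - G x) $ i - (x - G x) $ j \<le> \<alpha>" for i j
    by (simp add: hilbert_displacement_set_def hilbert_seminorm_le_iff)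
  moreover have "(G x - T x) $ i - (G x - T x) $ j \<le> K" for i j
    using assms[of x] hilbert_seminorm_le_iff by blast
  ultimately have "(x - T x) $ i - (x - T x) $ j \<le> \<alpha> + K" for i j
    by (smt (verit) vector_minus_component)
  then show "x \<in> hilbert_displacement_set (\<alpha> + K) T"
    by (simp add: hilbert_displacement_set_def hilbert_seminorm_le_iff)
qed

text \<open>All coordinates of \<open>x - T x\<close> lie between -\<beta> and -\<alpha>. The
  \<open>max\<close> keeps the level nonnegative when \<beta> < \<alpha>, where the slice is
  empty.\<close>

lemma slice_space_subset_hilbert_displacement_set:
  "slice_space \<alpha> \<beta> T \<subseteq> hilbert_displacement_set (max 0 (\<beta> - \<alpha>)) T"
proof
  fix x
  assume "x \<in> slice_space \<alpha> \<beta> T"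
  then have "\<alpha> + x $ i \<le> T x $ i" "T x $ i \<le> \<beta> + x $ i" for i
    by (simp_all add: slice_space_def less_eq_vec_def)
  then have "(x - T x) $ i - (x - T x) $ j \<le> max 0 (\<beta> - \<alpha>)" for i j
    by (smt (verit) vector_minus_component)
  then show "x \<in> hilbert_displacement_set (max 0 (\<beta> - \<alpha>)) T"
    by (simp add: hilbert_displacement_set_def hilbert_seminorm_le_iff)
qed

text \<open>At a maximal coordinate of \<open>x\<close>, \<open>T x - x\<close> is at most \<open>T 0\<close>; at a minimal one, at least
  \<open>T 0\<close>. Hence bounding the oscillation of \<open>T x - x\<close> already bounds \<open>T x - x\<close> itself.\<close>

lemma hilbert_displacement_set_subset_slice_space:
  assumes "mono T" "additively_homogeneous T"
  shows "hilbert_displacement_set \<alpha> T \<subseteq> slice_space (- norm (T 0) - \<alpha>) (norm (T 0) + \<alpha>) T"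
proof
  fix x
  assume x: "x \<in> hilbert_displacement_set \<alpha> T"
  have osc: "(x - T x) $ i - (x - T x) $ j \<le> \<alpha>" for i j
    using x by (simp add: hilbert_displacement_set_def hilbert_seminorm_le_iff)
  obtain p q where p: "\<And>k. x $ k \<le> x $ p" and q: "\<And>k. x $ q \<le> x $ k"
    using hilbert_seminorm_attained[of x] by metis
  have "T x $ p \<le> T 0 $ p + x $ p"
    by (rule mono_homogeneous_nth_le[OF assms]) (simp add: p)
  moreover have "T 0 $ q \<le> T x $ q + - (x $ q)"
    by (rule mono_homogeneous_nth_le[OF assms]) (simp add: q)
  moreover have "\<bar>T 0 $ p\<bar> \<le> norm (T 0)" "\<bar>T 0 $ q\<bar> \<le> norm (T 0)"
    by (rule component_le_norm_cart)+
  ultimately have "- norm (T 0) - \<alpha> + x $ i \<le> T x $ i \<and> T x $ i \<le> norm (T 0) + \<alpha> + x $ i" for i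
    using osc[of i q] osc[of p i] unfolding vector_minus_component by linarith
  then show "x \<in> slice_space (- norm (T 0) - \<alpha>) (norm (T 0) + \<alpha>) T"
    by (simp add: slice_space_def less_eq_vec_def)
qed

lemma hilbert_bounded_subset: "hilbert_bounded S \<Longrightarrow> R \<subseteq> S \<Longrightarrow> hilbert_bounded R"
  unfolding hilbert_bounded_def by blast

lemma hilbert_bounded_displacement_sets_iff_slice_spaces:
  assumes "mono T" "additively_homogeneous T"
  shows "(\<forall>\<alpha>\<ge>0. hilbert_bounded (hilbert_displacement_set \<alpha> T)) \<longleftrightarrow>
    (\<forall>\<alpha> \<beta>. hilbert_bounded (slice_space \<alpha> \<beta> T))"
  using hilbert_displacement_set_subset_slice_space[OF assms]
    slice_space_subset_hilbert_displacement_set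
  by (metis hilbert_bounded_subset max.cobounded1)

section \<open>From bounded displacement sets to the ergodic equation\<close>

text \<open>Scaling by \<open>1 - a\<close> makes a large cube invariant. The fixed point may grow
  like \<open>1 / a\<close>, but the bound on \<open>a * \<bar>v $ i\<bar>\<close> does not depend
  on \<open>a\<close>.\<close>

lemma discounted_fixed_point:
  fixes G :: "real ^ 'n \<Rightarrow> real ^ 'n"
  assumes "mono G" "additively_homogeneous G" "0 < a" "a \<le> 1"
  obtains v where "G ((1 - a) *\<^sub>R v) = v" "\<And>i. a * \<bar>v $ i\<bar> \<le> norm (G 0)"
proof -
  \<comment> \<open>This radius satisfies \<open>(1 - a) * R + norm (G 0) = R\<close>, which is
    exactly what invariance of the cube requires.\<close>
  define R where "R = norm (G 0) / a"
  define C where "C = cbox ((- R) *\<^sub>R 1) (R *\<^sub>R (1 :: real ^ 'n))"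
  have C_iff: "v \<in> C \<longleftrightarrow> (\<forall>i. \<bar>v $ i\<bar> \<le> R)" for v
    by (simp add: C_def mem_box_cart abs_le_iff minus_le_iff[of R] conj_commute)
  have "R \<ge> 0" using assms(3) by (simp add: R_def)
  then have "0 \<in> C" by (simp add: C_iff)
  have self: "G ((1 - a) *\<^sub>R v) \<in> C" if "v \<in> C" for v
  proof -
    have "\<bar>G ((1 - a) *\<^sub>R v) $ i\<bar> \<le> R" for i
    proof -
      have "\<bar>G ((1 - a) *\<^sub>R v) $ i - G 0 $ i\<bar> \<le> (1 - a) * R"
        using that assms(4)
        by (intro mono_homogeneous_nth_nonexpansive[OF assms(1,2)])
          (simp add: C_iff abs_mult mult_left_mono)
      moreover have "\<bar>G 0 $ i\<bar> \<le> a * R"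
        using component_le_norm_cart[of "G 0" i] assms(3) by (simp add: R_def)
      ultimately show ?thesis by (simp add: algebra_simps)
    qed
    then show ?thesis by (simp add: C_iff)
  qed
  have "continuous_on C (\<lambda>v. G ((1 - a) *\<^sub>R v))"
    by (rule continuous_on_compose2[OF continuous_on_mono_homogeneous[OF assms(1,2), of UNIV]])
      (auto intro!: continuous_intros)
  moreover have "compact C" "convex C" unfolding C_def by simp_all
  ultimately obtain v where v: "v \<in> C" "G ((1 - a) *\<^sub>R v) = v"
    using brouwer[of C "\<lambda>v. G ((1 - a) *\<^sub>R v)"] self \<open>0 \<in> C\<close> by blast
  have "a * \<bar>v $ i\<bar> \<le> norm (G 0)" for i
    using v(1) assms(3) by (simp add: C_iff R_def field_simps)
  with v(2) show thesis by (rule that)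
qed

lemma ergodic_solution_if_displacement_sets_bounded:
  fixes G :: "real ^ 'n \<Rightarrow> real ^ 'n"
  assumes G: "mono G" "additively_homogeneous G"
    and bdd: "\<And>\<alpha>. \<alpha> \<ge> 0 \<Longrightarrow> hilbert_bounded (hilbert_displacement_set \<alpha> G)"
  shows "\<exists>\<mu> u. G u = \<mu> *\<^sub>R 1 + u"
proof -
  \<comment> \<open>For a discounted fixed point \<open>v\<close>, the displacement of
    \<open>(1 - a) *\<^sub>R v\<close> is \<open>a *\<^sub>R v\<close>, with coordinates at most
    \<open>norm (G 0)\<close> in absolute value. Hence one level, and one bound \<open>B\<close>,
    serves all \<open>a\<close>.\<close>
  have "hilbert_bounded (hilbert_displacement_set (2 * norm (G 0)) G)" by (rule bdd) simp
  then obtain B where B: "\<And>x. x \<in> hilbert_displacement_set (2 * norm (G 0)) G \<Longrightarrow> hilbert_seminorm x \<le> B"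
    unfolding hilbert_bounded_def by blast
  define C where "C = cbox 0 (B *\<^sub>R (1 :: real ^ 'n))"
  have approx: "\<exists>y\<in>C. \<forall>i j. (G y - y) $ i - (G y - y) $ j \<le> t * B" if "t > 0" for t
  proof -
    \<comment> \<open>Chosen so that \<open>a *\<^sub>R v = t *\<^sub>R u\<close> for
      \<open>u = (1 - a) *\<^sub>R v\<close>: the displacement of \<open>u\<close> is
      \<open>t\<close> times \<open>u\<close>, whose oscillation is at most
      \<open>B\<close>.\<close>
    define a where "a = t / (1 + t)"
    have a: "0 < a" "a \<le> 1" "a = t * (1 - a)" using that by (auto simp: a_def field_simps)
    obtain v where v: "G ((1 - a) *\<^sub>R v) = v" "\<And>i. a * \<bar>v $ i\<bar> \<le> norm (G 0)"
      using discounted_fixed_point[OF G a(1,2)] by blast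
    define u where "u = (1 - a) *\<^sub>R v"
    have Gu: "G u - u = a *\<^sub>R v" using v(1) by (simp add: u_def algebra_simps)
    have tu: "a *\<^sub>R v = t *\<^sub>R u" using a(3) by (simp add: u_def)
    have av: "\<bar>a * v $ i\<bar> \<le> norm (G 0)" for i using v(2)[of i] a(1) by (simp add: abs_mult)
    have "(u - G u) $ i = - (a * v $ i)" for i
      using arg_cong[OF Gu, of "\<lambda>x. x $ i"] by simp
    then have "(u - G u) $ i - (u - G u) $ j \<le> 2 * norm (G 0)" for i j
      using av[of i] av[of j] by (simp only: abs_le_iff) linarith
    then have "u \<in> hilbert_displacement_set (2 * norm (G 0)) G"
      by (simp add: hilbert_displacement_set_def hilbert_seminorm_le_iff)
    then have uB: "u $ i - u $ j \<le> B" for i j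
      using B hilbert_seminorm_le_iff by blast
    obtain q where q: "\<And>k. u $ q \<le> u $ k" using hilbert_seminorm_attained[of u] by metis
    \<comment> \<open>Shifting the minimum to 0 leaves the displacement unchanged and puts the point
      in the compact cube \<open>C\<close>, where limit points exist.\<close>
    define y where "y = u + (- u $ q) *\<^sub>R 1"
    have "y \<in> C" using q uB[of _ q] by (simp add: C_def y_def mem_box_cart)
    have "G y - y = G u - u"
      using G(2) unfolding additively_homogeneous_def y_def by (metis add_diff_cancel_right)
    then have "G y - y = t *\<^sub>R u" using Gu tu by simp
    then have "(G y - y) $ i - (G y - y) $ j = t * (u $ i - u $ j)" for i j
      by (simp add: algebra_simps)
    then have "(G y - y) $ i - (G y - y) $ j \<le> t * B" for i j
      using uB that by (simp add: mult_left_mono)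
    with \<open>y \<in> C\<close> show ?thesis by blast
  qed
  have "\<exists>y\<in>C. \<forall>i j. (G y - y) $ i - (G y - y) $ j \<le> inverse (real (Suc n)) * B" for n
    by (rule approx) simp
  then obtain Y where Y: "\<And>n. Y n \<in> C"
    "\<And>n i j. (G (Y n) - Y n) $ i - (G (Y n) - Y n) $ j \<le> inverse (real (Suc n)) * B"
    by metis
  have "compact C" by (simp add: C_def)
  then obtain y r where r: "strict_mono r" and lim: "(Y \<circ> r) \<longlonglongrightarrow> y"
    using Y(1) unfolding compact_def by metis
  have "isCont G y"
    using continuous_on_mono_homogeneous[OF G, of UNIV] by (simp add: continuous_on_eq_continuous_at)
  then have "(\<lambda>n. G ((Y \<circ> r) n)) \<longlonglongrightarrow> G y" using lim by (rule isCont_tendsto_compose)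
  then have D: "(\<lambda>n. G ((Y \<circ> r) n) - (Y \<circ> r) n) \<longlonglongrightarrow> G y - y" using lim by (rule tendsto_diff)
  have "(\<lambda>n. inverse (real (Suc n)) * B) \<longlonglongrightarrow> 0 * B"
    by (intro tendsto_mult LIMSEQ_inverse_real_of_nat tendsto_const)
  then have Z: "((\<lambda>n. inverse (real (Suc n)) * B) \<circ> r) \<longlonglongrightarrow> 0"
    using r by (auto intro: LIMSEQ_subseq_LIMSEQ)
  have "(G y - y) $ i - (G y - y) $ j \<le> 0" for i j
  proof (rule LIMSEQ_le[OF _ Z])
    show "(\<lambda>n. (G ((Y \<circ> r) n) - (Y \<circ> r) n) $ i - (G ((Y \<circ> r) n) - (Y \<circ> r) n) $ j)
      \<longlonglongrightarrow> (G y - y) $ i - (G y - y) $ j"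
      by (rule tendsto_diff[OF tendsto_vec_nth[OF D] tendsto_vec_nth[OF D]])
    show "\<exists>N. \<forall>n\<ge>N. (G ((Y \<circ> r) n) - (Y \<circ> r) n) $ i - (G ((Y \<circ> r) n) - (Y \<circ> r) n) $ j
      \<le> ((\<lambda>n. inverse (real (Suc n)) * B) \<circ> r) n"
      using Y(2) by (metis comp_apply)
  qed
  then have "hilbert_seminorm (G y - y) \<le> 0" by (simp add: hilbert_seminorm_le_iff)
  then obtain c where "G y - y = c *\<^sub>R 1" using hilbert_seminorm_le_0D by blast
  then show ?thesis by (metis diff_add_cancel)
qed

section \<open>From the ergodic equation to bounded displacement sets\<close>

lemma displacement_sets_bounded_if_ergodic_solutions:
  fixes T :: "real ^ 'n \<Rightarrow> real ^ 'n"
  assumes T: "mono T" "additively_homogeneous T"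
    and solv: "\<And>g. \<exists>\<mu> u. g + T u = \<mu> *\<^sub>R 1 + u"
  shows "hilbert_bounded (hilbert_displacement_set \<alpha> T)"
proof (rule ccontr)
  assume "\<not> ?thesis"
  then have "\<forall>n. \<exists>x\<in>hilbert_displacement_set \<alpha> T. real (Suc n) < hilbert_seminorm x"
    unfolding hilbert_bounded_def by (metis not_le)
  then obtain X where X: "\<And>n. X n \<in> hilbert_displacement_set \<alpha> T"
    "\<And>n. real (Suc n) < hilbert_seminorm (X n)" by metis
  define N where "N n = hilbert_seminorm (X n)" for n
  have N: "real (Suc n) < N n" "0 < N n" for n
    using X(2)[of n] unfolding N_def by linarith+
  have "\<exists>p q. \<forall>k. X n $ q \<le> X n $ k \<and> (X n - T (X n)) $ k \<le> (X n - T (X n)) $ p" for n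
    using hilbert_seminorm_attained[of "X n"] hilbert_seminorm_attained[of "X n - T (X n)"] by metis
  then obtain p q where q: "\<And>n k. X n $ q n \<le> X n $ k"
    and p: "\<And>n k. (X n - T (X n)) $ k \<le> (X n - T (X n)) $ p n" by metis
  \<comment> \<open>Normalised representatives modulo constants: \<open>W n\<close> has minimum 0
    and maximum 1. Since \<open>p n\<close> minimises \<open>T (X n) - X n\<close>, the coordinates
    of \<open>D n\<close> lie between 0 and \<alpha>. So the pairs stay in a compact set.\<close>
  define W where "W n = inverse (N n) *\<^sub>R (X n - (X n $ q n) *\<^sub>R 1)" for n
  define D where "D n = T (X n) - X n + ((X n - T (X n)) $ p n) *\<^sub>R 1" for n
  have "(W n, D n) \<in> cbox 0 1 \<times> cbox 0 (\<alpha> *\<^sub>R 1)" for n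
  proof -
    have "X n $ k - X n $ q n \<le> N n" for k
      unfolding N_def by (rule diff_le_hilbert_seminorm)
    then have "W n \<in> cbox 0 1"
      using q[of n] N(2)[of n] by (simp add: W_def mem_box_cart field_simps)
    moreover have "(X n - T (X n)) $ p n - (X n - T (X n)) $ k \<le> \<alpha>" for k
      using X(1)[of n] hilbert_seminorm_le_iff[of "X n - T (X n)" \<alpha>]
      by (simp add: hilbert_displacement_set_def)
    then have "D n \<in> cbox 0 (\<alpha> *\<^sub>R 1)"
      using p[of n] by (simp add: D_def mem_box_cart algebra_simps)
    ultimately show ?thesis by blast
  qed
  moreover have "compact (cbox 0 (1 :: real ^ 'n) \<times> cbox 0 (\<alpha> *\<^sub>R (1 :: real ^ 'n)))"
    by (intro compact_Times compact_cbox)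
  ultimately obtain wd r where r: "strict_mono r" and lim: "((\<lambda>n. (W n, D n)) \<circ> r) \<longlonglongrightarrow> wd"
    unfolding compact_def by meson
  obtain w d where wd: "wd = (w, d)" by fastforce
  have limW: "(\<lambda>n. W (r n)) \<longlonglongrightarrow> w" and limD: "(\<lambda>n. D (r n)) \<longlonglongrightarrow> d"
    using tendsto_fst[OF lim] tendsto_snd[OF lim] by (simp_all add: o_def wd)
  obtain \<mu> z where "(w - d) + T z = \<mu> *\<^sub>R 1 + z" using solv by blast
  then have z: "T z $ i - z $ i = d $ i - w $ i + \<mu>" for i
    by (auto simp: vec_eq_iff algebra_simps dest: spec[of _ i])
  have "(\<lambda>n. inverse (real (Suc n)) * norm z) \<longlonglongrightarrow> 0 * norm z"
    by (intro tendsto_mult LIMSEQ_inverse_real_of_nat tendsto_const)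
  then have "((\<lambda>n. inverse (real (Suc n)) * norm z) \<circ> r) \<longlonglongrightarrow> 0"
    using r by (auto intro: LIMSEQ_subseq_LIMSEQ)
  \<comment> \<open>With tolerance 1/16, four errors from \<open>z\<close> and two from
    \<open>W\<close> give \<open>w $ i - w $ j > 5/8\<close>, while two errors from \<open>D\<close>
    give at most 1/8.\<close>
  then have "eventually (\<lambda>n. inverse (real (Suc (r n))) * norm z < 1 / 16) sequentially"
    by (auto dest: order_tendstoD(2)[of _ _ _ "1/16"])
  moreover have "eventually (\<lambda>n. dist (W (r n)) w < 1 / 16) sequentially"
    "eventually (\<lambda>n. dist (D (r n)) d < 1 / 16) sequentially"
    using tendstoD[OF limW, of "1/16"] tendstoD[OF limD, of "1/16"] by simp_all
  ultimately have "eventually (\<lambda>n. inverse (real (Suc (r n))) * norm z < 1 / 16 \<and>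
    dist (W (r n)) w < 1 / 16 \<and> dist (D (r n)) d < 1 / 16) sequentially"
    by (intro eventually_conj)
  then obtain m where m: "inverse (real (Suc (r m))) * norm z < 1 / 16"
    "dist (W (r m)) w < 1 / 16" "dist (D (r m)) d < 1 / 16"
    by (auto simp: eventually_sequentially)
  define n where "n = r m"
  define x where "x = X n"
  define s where "s = inverse (N n)"
  have s: "0 < s" "s * N n = 1" using N(2)[of n] by (simp_all add: s_def)
  have small: "\<bar>s * z $ k\<bar> < 1 / 16" for k
  proof -
    have "s \<le> inverse (real (Suc n))" unfolding s_def
      by (rule le_imp_inverse_le) (use N(1)[of n] in auto)
    then have "s * \<bar>z $ k\<bar> \<le> inverse (real (Suc n)) * norm z"
      by (rule mult_mono) (use component_le_norm_cart[of z k] in auto)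
    then show ?thesis using m(1) s(1) by (simp add: abs_mult n_def)
  qed
  have closeW: "\<bar>W n $ k - w $ k\<bar> < 1 / 16" for k
    using component_le_norm_cart[of "W n - w" k] m(2) by (simp add: n_def dist_norm)
  have closeD: "\<bar>D n $ k - d $ k\<bar> < 1 / 16" for k
    using component_le_norm_cart[of "D n - d" k] m(3) by (simp add: n_def dist_norm)
  have Wx: "W n $ k - W n $ l = s * (x $ k - x $ l)" for k l
    by (simp add: W_def x_def s_def algebra_simps)
  have Dx: "D n $ k - D n $ l = (T x - x) $ k - (T x - x) $ l" for k l
    by (simp add: D_def x_def)
  obtain i j where i: "\<And>k. (x - z) $ k \<le> (x - z) $ i" and j: "\<And>k. (x - z) $ j \<le> (x - z) $ k"
    using hilbert_seminorm_attained[of "x - z"] by metis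
  have "T x $ i \<le> T z $ i + (x - z) $ i"
    by (rule mono_homogeneous_nth_le[OF T]) (use i in \<open>simp add: algebra_simps\<close>)
  moreover have "T z $ j \<le> T x $ j + - ((x - z) $ j)"
    by (rule mono_homogeneous_nth_le[OF T]) (use j in \<open>simp add: algebra_simps\<close>)
  ultimately have "(T x - x) $ i - (T x - x) $ j \<le> (T z $ i - z $ i) - (T z $ j - z $ j)"
    by simp
  then have "D n $ i - D n $ j \<le> (d $ i - w $ i) - (d $ j - w $ j)"
    by (simp add: Dx z)
  then have upper: "w $ i - w $ j \<le> 1 / 8"
    using closeD[of i] closeD[of j] by linarith
  obtain a b where ab: "N n = x $ a - x $ b"
    using hilbert_seminorm_attained[of x] unfolding N_def x_def by metis
  \<comment> \<open>The spread of \<open>x - z\<close> at its extremal coordinates dominates its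
    spread at \<open>a\<close>, \<open>b\<close>, where \<open>x\<close> realises its full
    oscillation \<open>N n\<close>. After scaling by \<open>s\<close> the terms in \<open>z\<close>
    are small, so \<open>W n\<close> has spread near 1 between \<open>i\<close> and
    \<open>j\<close>.\<close>
  have "x $ a - x $ b - (z $ a - z $ b) \<le> x $ i - x $ j - (z $ i - z $ j)"
    using i[of a] j[of b] by simp
  then have "s * (x $ a - x $ b - (z $ a - z $ b)) \<le> s * (x $ i - x $ j - (z $ i - z $ j))"
    using s(1) by (simp add: mult_left_mono)
  then have "1 - (s * z $ a - s * z $ b) \<le> W n $ i - W n $ j - (s * z $ i - s * z $ j)"
    using s(2) unfolding Wx ab by (simp add: right_diff_distrib)
  then have "W n $ i - W n $ j > 3 / 4"
    using small[of a] small[of b] small[of i] small[of j] by linarith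
  then show False using upper closeW[of i] closeW[of j] by linarith
qed

theorem theorem5p1:
  fixes T :: "real ^ 'n \<Rightarrow> real ^ 'n"
  assumes "mono T" and "additively_homogeneous T"
  shows
    "((\<forall>g :: real ^ 'n. \<exists>(\<mu> :: real) (u :: real ^ 'n). g + T u = \<mu> *\<^sub>R 1 + u) \<longleftrightarrow>
      (\<forall>G :: real ^ 'n \<Rightarrow> real ^ 'n.
         mono G \<and> additively_homogeneous G \<and>
         bdd_above (range (\<lambda>x. hilbert_seminorm (G x - T x))) \<longrightarrow>
         (\<exists>(\<mu> :: real) (u :: real ^ 'n). G u = \<mu> *\<^sub>R 1 + u))) \<and>
     ((\<forall>g :: real ^ 'n. \<exists>(\<mu> :: real) (u :: real ^ 'n). g + T u = \<mu> *\<^sub>R 1 + u) \<longleftrightarrow>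
      (\<forall>\<alpha>\<ge>0. hilbert_bounded (hilbert_displacement_set \<alpha> T))) \<and>
     ((\<forall>g :: real ^ 'n. \<exists>(\<mu> :: real) (u :: real ^ 'n). g + T u = \<mu> *\<^sub>R 1 + u) \<longleftrightarrow>
      (\<forall>\<alpha> \<beta>. hilbert_bounded (slice_space \<alpha> \<beta> T)))"
proof -
  \<comment> \<open>The implications form the cycle \<open>?E\<close>, \<open>?D\<close>,
    \<open>?G\<close>, \<open>?E\<close>; slice spaces are attached through
    \<open>?D\<close>.\<close>
  let ?E = "\<forall>g :: real ^ 'n. \<exists>\<mu> u. g + T u = \<mu> *\<^sub>R 1 + u"
  let ?G = "\<forall>G :: real ^ 'n \<Rightarrow> real ^ 'n. mono G \<and> additively_homogeneous G \<and>
    bdd_above (range (\<lambda>x. hilbert_seminorm (G x - T x))) \<longrightarrow> (\<exists>\<mu> u. G u = \<mu> *\<^sub>R 1 + u)"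
  let ?D = "\<forall>\<alpha>\<ge>0. hilbert_bounded (hilbert_displacement_set \<alpha> T)"
  have ED: "?E \<Longrightarrow> ?D"
    using displacement_sets_bounded_if_ergodic_solutions[OF assms] by blast
  have DG: ?G if D: ?D
  proof (intro allI impI)
    fix G :: "real ^ 'n \<Rightarrow> real ^ 'n"
    assume G: "mono G \<and> additively_homogeneous G \<and>
      bdd_above (range (\<lambda>x. hilbert_seminorm (G x - T x)))"
    then obtain K where K: "\<And>x. hilbert_seminorm (G x - T x) \<le> K"
      by (auto simp: bdd_above_def)
    \<comment> \<open>Ensures that the enlarged level \<open>\<alpha> + K\<close> is still
      nonnegative, as \<open>?D\<close> requires.\<close>
    have "K \<ge> 0" using K[of 0] hilbert_seminorm_nonneg[of "G 0 - T 0"] by linarith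
    have "hilbert_bounded (hilbert_displacement_set \<alpha> G)" if "\<alpha> \<ge> 0" for \<alpha>
    proof (rule hilbert_bounded_subset)
      show "hilbert_bounded (hilbert_displacement_set (\<alpha> + K) T)"
        using D that \<open>K \<ge> 0\<close> by simp
      show "hilbert_displacement_set \<alpha> G \<subseteq> hilbert_displacement_set (\<alpha> + K) T"
        using K by (rule hilbert_displacement_set_subset)
    qed
    with G show "\<exists>\<mu> u. G u = \<mu> *\<^sub>R 1 + u"
      by (intro ergodic_solution_if_displacement_sets_bounded) auto
  qed
  have GE: ?E if ?G
  proof
    fix g :: "real ^ 'n"
    have "mono (\<lambda>x. g + T x)" using assms(1) by (simp add: mono_def)
    moreover have "additively_homogeneous (\<lambda>x. g + T x)"
      using assms(2) by (simp add: additively_homogeneous_def)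
    moreover have "bdd_above (range (\<lambda>x. hilbert_seminorm (g + T x - T x)))" by simp
    ultimately show "\<exists>\<mu> u. g + T u = \<mu> *\<^sub>R 1 + u"
      using that[rule_format, of "\<lambda>x. g + T x"] by blast
  qed
  show ?thesis
    using ED DG GE hilbert_bounded_displacement_sets_iff_slice_spaces[OF assms] by argo
qed

end
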